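(* Let $d$ be a fixed positive integer. Then, as $n\to\infty$: (i) $\alpha_n^d=n^d-(2^d-1)n^{d-1}+\mathcal{O}(n^{d-2})$; (ii) $\lim_{n\to\infty}\frac{\alpha_n^d}{n^d}=1$; (iii) $\lim_{n\to\infty}\frac{\alpha_{n+1}^d}{\alpha_n^d}=1$.
   Context: $\mathbb{Z}_n$ is the ring of integers modulo $n$; a vector $(v_1,\dots,v_d)\in\mathbb{Z}_n^d$ is zero-sum-free if no non-empty subset of its components sums to $0$ in $\mathbb{Z}_n$; $\alpha_n^d$ is the number of such vectors. $a_n=\mathcal{O}(b_n)$ means there are a constant $K>0$ and an integer $N$ with $|a_n|\leq K b_n$ for all $n\geq N$. *)

theory Defs
  imports Complex_Main "HOL-Library.FuncSet" "HOL-Library.Landau_Symbols" "HOL-Number_Theory.Cong"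
begin

text \<open>A vector of length \<open>d\<close> over the integers modulo \<open>n\<close> is represented by the least
  non-negative residues of its components: an extensional function from \<open>{1..d}\<close> to
  \<open>{0..<int n}\<close>. Subsets of the components are sets of indices, so equal entries at
  different positions count separately.\<close>

definition Zn_vectors :: "nat \<Rightarrow> nat \<Rightarrow> (nat \<Rightarrow> int) set" where
  "Zn_vectors n d = {1..d} \<rightarrow>\<^sub>E {0..<int n}"

definition zero_sum_free :: "nat \<Rightarrow> nat \<Rightarrow> (nat \<Rightarrow> int) \<Rightarrow> bool" where
  "zero_sum_free n d v \<longleftrightarrow>
     \<not> (\<exists>S. S \<subseteq> {1..d} \<and> S \<noteq> {} \<and> [(\<Sum>i\<in>S. v i) = 0] (mod int n))"

definition alpha :: "nat \<Rightarrow> nat \<Rightarrow> nat" where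
  "alpha n d = card {v \<in> Zn_vectors n d. zero_sum_free n d v}"

end

theory Submission imports Defs begin

text \<open>
  For a non-empty index set \<open>S\<close>, the condition \<open>\<Sum>i\<in>S. v i = 0\<close> determines one coordinate
  \<open>v i\<close> with \<open>i \<in> S\<close> from the others, so it holds for exactly \<open>n ^ (d - 1)\<close> vectors. If
  \<open>S \<noteq> T\<close>, some index lies in exactly one of the two sets, so the two conditions fix two
  coordinates one after the other and hold together for exactly \<open>n ^ (d - 2)\<close> vectors. The
  Bonferroni inequalities for the \<open>2 ^ d - 1\<close> conditions then give the expansion, and the
  limits follow from it.
\<close>

text \<open>Second-order Bonferroni inequality by induction on \<open>I\<close>: a new set adds its
  cardinality minus its overlap with the old union, and that overlap is at most the sum of the
  pairwise overlaps. Ordered pairs are summed, so each overlap counts twice; this affects only the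
  constant of the error term.\<close>

lemma bonferroni_lower:
  assumes "finite I" "\<And>i. i \<in> I \<Longrightarrow> finite (A i)"
  shows "(\<Sum>i\<in>I. card (A i)) \<le> card (\<Union>i\<in>I. A i) + (\<Sum>i\<in>I. \<Sum>j\<in>I - {i}. card (A i \<inter> A j))"
  using assms
proof (induction I rule: finite_induct)
  case empty
  then show ?case by simp
next
  case (insert x I)
  let ?U = "\<Union>i\<in>I. A i"
  have "A x \<inter> ?U = (\<Union>j\<in>I. A x \<inter> A j)" by blast
  then have meet: "card (A x \<inter> ?U) \<le> (\<Sum>j\<in>I. card (A x \<inter> A j))"
    using card_UN_le[OF insert.hyps(1), of "\<lambda>j. A x \<inter> A j"] by simp
  have union: "card (A x) + card ?U = card (A x \<union> ?U) + card (A x \<inter> ?U)"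
    using insert by (intro card_Un_Int) auto
  have "insert x I - {x} = I" using insert.hyps by blast
  \<comment> \<open>The row of \<open>x\<close> alone pays for the new overlap; in the old rows the
    extra terms \<open>A i \<inter> A x\<close> are just bounded below by 0.\<close>
  moreover have "(\<Sum>i\<in>I. \<Sum>j\<in>I - {i}. card (A i \<inter> A j))
      \<le> (\<Sum>i\<in>I. \<Sum>j\<in>insert x I - {i}. card (A i \<inter> A j))"
    using insert.hyps by (intro sum_mono sum_mono2) auto
  ultimately show ?case
    using insert.IH insert.prems insert.hyps meet union by simp
qed

text \<open>Once the other coordinates are chosen, the congruence has exactly one solution for
  coordinate \<open>i\<close>, whereas in the right-hand set that coordinate is free among
  \<open>n\<close> values. The side condition \<open>Q\<close>, blind to coordinate
  \<open>i\<close>, leaves room for a second congruence.\<close>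

lemma card_zero_sum_times:
  fixes Q :: "('a \<Rightarrow> int) \<Rightarrow> bool"
  assumes "finite S" "S \<subseteq> I" "i \<in> S" "n > 0"
    and Q: "\<And>v t. Q (v(i := t)) = Q v"
  shows "card {v \<in> I \<rightarrow>\<^sub>E {0..<int n}. [(\<Sum>j\<in>S. v j) = 0] (mod int n) \<and> Q v} * n
       = card {v \<in> I \<rightarrow>\<^sub>E {0..<int n}. Q v}"
proof -
  let ?A = "{v \<in> I \<rightarrow>\<^sub>E {0..<int n}. [(\<Sum>j\<in>S. v j) = 0] (mod int n) \<and> Q v}"
  let ?B = "{v \<in> I \<rightarrow>\<^sub>E {0..<int n}. Q v}"
  \<comment> \<open>The residue that coordinate \<open>i\<close> must take for the sum over
    \<open>S\<close> to vanish.\<close>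
  let ?c = "\<lambda>v. (- (\<Sum>j\<in>S - {i}. v j)) mod int n"
  have split: "(\<Sum>j\<in>S. v j) = v i + (\<Sum>j\<in>S - {i}. v j)" for v :: "'a \<Rightarrow> int"
    using assms by (simp add: sum.remove)
  have rest: "(\<Sum>j\<in>S - {i}. (v(i := t)) j) = (\<Sum>j\<in>S - {i}. v j)" for v :: "'a \<Rightarrow> int" and t
    by (rule sum.cong) auto
  have iI: "i \<in> I" using assms by blast
  have upd: "v(i := t) \<in> I \<rightarrow>\<^sub>E {0..<int n}"
    if "v \<in> I \<rightarrow>\<^sub>E {0..<int n}" "t \<in> {0..<int n}" for v t
    using that iI by (auto simp: PiE_iff extensional_def)
  have c_range: "?c v \<in> {0..<int n}" for v using assms by simp
  have solve: "?c v = v i" if "v \<in> ?A" for v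
  proof -
    have "v i \<in> {0..<int n}" using that iI by blast
    moreover have "[v i = - (\<Sum>j\<in>S - {i}. v j)] (mod int n)"
      using that split[of v] by (simp add: cong_iff_dvd_diff)
    ultimately show ?thesis by (simp add: cong_def)
  qed
  \<comment> \<open>Overwriting coordinate \<open>i\<close> by \<open>t\<close> loses nothing, since
    the old entry is recovered as \<open>?c\<close>; the inverse restores it and returns
    \<open>t\<close> separately.\<close>
  have "bij_betw (\<lambda>(v, t). v(i := t)) (?A \<times> {0..<int n}) ?B"
  proof (rule bij_betw_byWitness[where f' = "\<lambda>u. (u(i := ?c u), u i)"])
    show "\<forall>p\<in>?A \<times> {0..<int n}. (\<lambda>u. (u(i := ?c u), u i)) ((\<lambda>(v, t). v(i := t)) p) = p"
      using solve by (auto simp: rest simp del: fun_upd_apply) (auto simp: fun_upd_idem)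
    show "\<forall>u\<in>?B. (\<lambda>(v, t). v(i := t)) ((\<lambda>u. (u(i := ?c u), u i)) u) = u"
      by simp
    show "(\<lambda>(v, t). v(i := t)) ` (?A \<times> {0..<int n}) \<subseteq> ?B"
    proof (intro image_subsetI)
      fix p assume "p \<in> ?A \<times> {0..<int n}"
      then show "(\<lambda>(v, t). v(i := t)) p \<in> ?B"
        using upd[of "fst p" "snd p"] Q by (cases p) simp
    qed
    show "(\<lambda>u. (u(i := ?c u), u i)) ` ?B \<subseteq> ?A \<times> {0..<int n}"
    proof (intro image_subsetI)
      fix u assume u: "u \<in> ?B"
      have "[(\<Sum>j\<in>S. (u(i := ?c u)) j) = 0] (mod int n)"
        unfolding split[of "u(i := ?c u)"] rest by (simp add: cong_def mod_simps)
      moreover have "u i \<in> {0..<int n}" using u iI by blast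
      ultimately show "(u(i := ?c u), u i) \<in> ?A \<times> {0..<int n}"
        using u upd[of u "?c u"] c_range[of u] Q by simp
    qed
  qed
  then have "card (?A \<times> {0..<int n}) = card ?B" by (rule bij_betw_same_card)
  then show ?thesis by (simp add: card_cartesian_product)
qed

definition zero_sum_set :: "nat \<Rightarrow> nat \<Rightarrow> nat set \<Rightarrow> (nat \<Rightarrow> int) set" where
  "zero_sum_set n d S = {v \<in> Zn_vectors n d. [(\<Sum>i\<in>S. v i) = 0] (mod int n)}"

lemma finite_Zn_vectors: "finite (Zn_vectors n d)"
  by (simp add: Zn_vectors_def finite_PiE)

lemma card_Zn_vectors: "card (Zn_vectors n d) = n ^ d"
  by (simp add: Zn_vectors_def card_PiE)

lemma finite_zero_sum_set: "finite (zero_sum_set n d S)"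
  by (simp add: zero_sum_set_def finite_Zn_vectors)

lemma card_zero_sum_set:
  assumes "S \<subseteq> {1..d}" "S \<noteq> {}" "n > 0"
  shows "card (zero_sum_set n d S) * n = n ^ d"
proof -
  obtain i where "i \<in> S" using assms by blast
  then show ?thesis
    using card_zero_sum_times[of S "{1..d}" i n "\<lambda>_. True"] assms finite_subset[OF assms(1)]
      card_Zn_vectors[of n d]
    by (simp add: zero_sum_set_def Zn_vectors_def)
qed

text \<open>An index in exactly one of the two sets eliminates that set's congruence while the other
  serves as \<open>Q\<close>; the remaining congruence is then eliminated alone. Each elimination
  costs a factor \<open>n\<close>.\<close>

lemma card_zero_sum_set_Int:
  assumes "S \<subseteq> {1..d}" "S \<noteq> {}" "T \<subseteq> {1..d}" "T \<noteq> {}" "S \<noteq> T" "n > 0"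
  shows "card (zero_sum_set n d S \<inter> zero_sum_set n d T) * n\<^sup>2 = n ^ d"
proof -
  \<comment> \<open>Stated for arbitrary \<open>S\<close> and \<open>T\<close>, because the
    separating index may lie in either of the given sets.\<close>
  have *: "card (zero_sum_set n d S \<inter> zero_sum_set n d T) * n = card (zero_sum_set n d T)"
    if "S \<subseteq> {1..d}" "i \<in> S" "i \<notin> T" for S T i
  proof -
    have "(\<Sum>j\<in>T. (v(i := t)) j) = (\<Sum>j\<in>T. v j)" for v :: "nat \<Rightarrow> int" and t
      using that by (intro sum.cong) auto
    moreover have "zero_sum_set n d S \<inter> zero_sum_set n d T
      = {v \<in> Zn_vectors n d. [(\<Sum>j\<in>S. v j) = 0] (mod int n) \<and> [(\<Sum>j\<in>T. v j) = 0] (mod int n)}"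
      by (auto simp: zero_sum_set_def)
    ultimately show ?thesis
      using card_zero_sum_times[of S "{1..d}" i n "\<lambda>v. [(\<Sum>j\<in>T. v j) = 0] (mod int n)"]
        that assms(6) finite_subset[OF that(1)]
      by (simp add: zero_sum_set_def Zn_vectors_def del: fun_upd_apply)
  qed
  consider i where "i \<in> S" "i \<notin> T" | i where "i \<in> T" "i \<notin> S" using assms by blast
  then show ?thesis
  proof cases
    case 1
    then show ?thesis
      using *[of S i T] card_zero_sum_set[of T d n] assms
      by (simp add: power2_eq_square mult.assoc[symmetric])
  next
    case 2
    then show ?thesis
      using *[of T i S] card_zero_sum_set[of S d n] assms
      by (simp add: power2_eq_square mult.assoc[symmetric] Int_commute)
  qed
qed

text \<open>The zero-sum-free vectors are the complement of the union of the \<open>m\<close>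
  zero-sum sets. The union bound yields the lower estimate, Bonferroni the upper one. The integer
  exponent \<open>int d - 2\<close> keeps the case \<open>d = 1\<close> honest, where truncated
  subtraction would give 0 instead of -1.\<close>

lemma alpha_bounds:
  fixes n d :: nat
  assumes "d > 0" "n > 0"
  defines "m \<equiv> (2 ^ d - 1 :: real)"
  shows alpha_le: "real (alpha n d) \<le> real n ^ d"
    and alpha_lower: "real n ^ d - m * real n ^ (d - 1) \<le> real (alpha n d)"
    and alpha_upper: "real (alpha n d)
          \<le> real n ^ d - m * real n ^ (d - 1) + m\<^sup>2 * real n powi (int d - 2)"
proof -
  define P where "P = Pow {1..d} - {{}}"
  define Z where "Z = zero_sum_set n d"
  define U where "U = (\<Union>S\<in>P. Z S)"
  define pairs where "pairs = (\<Sum>S\<in>P. \<Sum>T\<in>P - {S}. card (Z S \<inter> Z T))"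
  have finP: "finite P" by (simp add: P_def)
  have cardP: "real (card P) = m"
    by (simp add: P_def card_Diff_singleton card_Pow m_def of_nat_diff)
  have finZ: "finite (Z S)" for S by (simp add: Z_def finite_zero_sum_set)
  have cardZ: "real (card (Z S)) = real n ^ (d - 1)" if "S \<in> P" for S
  proof -
    have "card (Z S) * n = n ^ (d - 1) * n"
      using that card_zero_sum_set[of S d n] assms
      by (simp add: P_def Z_def power_minus_mult del: One_nat_def)
    then have "card (Z S) = n ^ (d - 1)" using assms by simp
    then show ?thesis by simp
  qed
  have cardZ2: "real (card (Z S \<inter> Z T)) = real n powi (int d - 2)"
    if "S \<in> P" "T \<in> P - {S}" for S T
  proof -
    have "card (Z S \<inter> Z T) * n\<^sup>2 = n ^ d"
      using that card_zero_sum_set_Int[of S d T n] assms by (auto simp: P_def Z_def)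
    then have "real (card (Z S \<inter> Z T)) * real n ^ 2 = real n ^ d"
      by (metis of_nat_mult of_nat_power)
    then show ?thesis using assms by (simp add: power_int_diff field_simps)
  qed
  have sumZ: "real (\<Sum>S\<in>P. card (Z S)) = m * real n ^ (d - 1)"
    by (simp add: cardZ cardP)
  have "real pairs \<le> (\<Sum>S\<in>P. \<Sum>T\<in>P. real n powi (int d - 2))"
    unfolding pairs_def of_nat_sum
  proof (rule sum_mono)
    fix S assume S: "S \<in> P"
    have "(\<Sum>T\<in>P - {S}. real (card (Z S \<inter> Z T))) = (\<Sum>T\<in>P - {S}. real n powi (int d - 2))"
      using cardZ2[OF S] by (rule sum.cong[OF refl])
    \<comment> \<open>Adding the non-negative diagonal term makes the number of pairs
      \<open>m\<^sup>2\<close> rather than \<open>m * (m - 1)\<close>.\<close>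
    also have "\<dots> \<le> (\<Sum>T\<in>P. real n powi (int d - 2))"
      by (rule sum_mono2) (auto simp: finP)
    finally show "(\<Sum>T\<in>P - {S}. real (card (Z S \<inter> Z T))) \<le> (\<Sum>T\<in>P. real n powi (int d - 2))" .
  qed
  then have pairs: "real pairs \<le> m\<^sup>2 * real n powi (int d - 2)"
    by (simp add: cardP power2_eq_square mult.assoc)
  have "{v \<in> Zn_vectors n d. zero_sum_free n d v} = Zn_vectors n d - U"
    by (auto simp: U_def P_def Z_def zero_sum_set_def zero_sum_free_def)
  moreover have UZ: "U \<subseteq> Zn_vectors n d" by (auto simp: U_def Z_def zero_sum_set_def)
  moreover have finU: "finite U" using finP finZ by (simp add: U_def)
  ultimately have "alpha n d = n ^ d - card U"
    by (simp add: alpha_def card_Diff_subset card_Zn_vectors)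
  moreover have "card U \<le> n ^ d"
    using card_mono[OF finite_Zn_vectors UZ] by (simp add: card_Zn_vectors)
  ultimately have alpha: "real (alpha n d) = real n ^ d - real (card U)"
    by (simp add: of_nat_diff)
  have "card U \<le> (\<Sum>S\<in>P. card (Z S))"
    unfolding U_def by (rule card_UN_le[OF finP])
  then have up: "real (card U) \<le> m * real n ^ (d - 1)"
    unfolding sumZ[symmetric] of_nat_le_iff .
  have "(\<Sum>S\<in>P. card (Z S)) \<le> card U + pairs"
    unfolding U_def pairs_def by (rule bonferroni_lower[OF finP finZ])
  then have "real (\<Sum>S\<in>P. card (Z S)) \<le> real (card U) + real pairs"
    by (metis of_nat_add of_nat_le_iff)
  then have low: "m * real n ^ (d - 1) \<le> real (card U) + real pairs"
    unfolding sumZ .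
  show "real (alpha n d) \<le> real n ^ d" using alpha by simp
  show "real n ^ d - m * real n ^ (d - 1) \<le> real (alpha n d)" using alpha up by simp
  show "real (alpha n d) \<le> real n ^ d - m * real n ^ (d - 1) + m\<^sup>2 * real n powi (int d - 2)"
    using alpha low pairs by simp
qed

lemma alpha_asymptotic:
  assumes "d > 0"
  shows "(\<lambda>n::nat. real (alpha n d) - (real n ^ d - (2 ^ d - 1) * real n ^ (d - 1)))
            \<in> O(\<lambda>n. real n powi (int d - 2))"
proof (rule bigoI[where c = "(2 ^ d - 1)\<^sup>2"])
  show "\<forall>\<^sub>F n in sequentially.
      norm (real (alpha n d) - (real n ^ d - (2 ^ d - 1) * real n ^ (d - 1)))
        \<le> (2 ^ d - 1)\<^sup>2 * norm (real n powi (int d - 2))"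
    using eventually_gt_at_top[of 0]
  proof eventually_elim
    case (elim n)
    then show ?case
      using alpha_lower[OF assms elim] alpha_upper[OF assms elim] by simp
  qed
qed

text \<open>Dividing the bounds by \<open>real n ^ d\<close> squeezes the density between
  \<open>1 - (2 ^ d - 1) / n\<close> and 1.\<close>

lemma alpha_density:
  assumes "d > 0"
  shows "(\<lambda>n::nat. real (alpha n d) / real n ^ d) \<longlonglongrightarrow> 1"
proof (rule tendsto_sandwich)
  show "\<forall>\<^sub>F n in sequentially. 1 - (2 ^ d - 1) / real n \<le> real (alpha n d) / real n ^ d"
    using eventually_gt_at_top[of 0]
  proof eventually_elim
    case (elim n)
    have "real n ^ d = real n ^ (d - 1) * real n"
      using assms by (rule power_minus_mult[symmetric])
    then have "(1 - (2 ^ d - 1) / real n) * real n ^ d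
        = real n ^ d - (2 ^ d - 1) * real n ^ (d - 1)"
      using elim by (simp add: field_simps)
    then show ?case
      using alpha_lower[OF assms elim] elim by (simp add: pos_le_divide_eq)
  qed
  show "\<forall>\<^sub>F n in sequentially. real (alpha n d) / real n ^ d \<le> 1"
    using eventually_gt_at_top[of 0]
  proof eventually_elim
    case (elim n)
    then show ?case using alpha_le[OF assms elim] by (simp add: pos_divide_le_eq)
  qed
  show "(\<lambda>n. 1 - (2 ^ d - 1) / real n) \<longlonglongrightarrow> 1"
    using tendsto_diff[OF tendsto_const lim_const_over_n[of "2 ^ d - 1 :: real"], of 1] by simp
qed simp

text \<open>The ratio factors into a quotient of consecutive densities, both tending to 1, and
  \<open>((n + 1) / n) ^ d\<close>.\<close>

lemma alpha_ratio:
  assumes "d > 0"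
  shows "(\<lambda>n::nat. real (alpha (n + 1) d) / real (alpha n d)) \<longlonglongrightarrow> 1"
proof -
  let ?r = "\<lambda>n. real (alpha n d) / real n ^ d"
  have "(\<lambda>n. real (Suc n) / real n) \<longlonglongrightarrow> 1" by (rule LIMSEQ_Suc_n_over_n)
  then have "(\<lambda>n. ?r (n + 1) / ?r n * (real (Suc n) / real n) ^ d) \<longlonglongrightarrow> 1 / 1 * 1 ^ d"
    using LIMSEQ_ignore_initial_segment[OF alpha_density[OF assms], of 1] alpha_density[OF assms]
    by (intro tendsto_mult tendsto_divide tendsto_power) auto
  then have lim: "(\<lambda>n. ?r (n + 1) / ?r n * (real (Suc n) / real n) ^ d) \<longlonglongrightarrow> 1" by simp
  \<comment> \<open>Only the powers of \<open>n\<close> and \<open>n + 1\<close> have to be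
    non-zero: if \<open>alpha n d = 0\<close>, both sides are 0 by the convention for division by
    zero.\<close>
  have "\<forall>\<^sub>F n in sequentially.
      ?r (n + 1) / ?r n * (real (Suc n) / real n) ^ d = real (alpha (n + 1) d) / real (alpha n d)"
    using eventually_gt_at_top[of 0]
  proof eventually_elim
    case (elim n)
    then have "real n ^ d \<noteq> 0" "real (Suc n) ^ d \<noteq> 0" by auto
    then show ?case by (simp add: power_divide)
  qed
  then show ?thesis by (rule Lim_transform_eventually[OF lim])
qed

theorem theorem6p1:
  fixes d :: nat
  assumes "d > 0"
  shows "((\<lambda>n::nat. real (alpha n d) - (real n ^ d - (2 ^ d - 1) * real n ^ (d - 1)))
            \<in> O(\<lambda>n. real n powi (int d - 2)))
       \<and> ((\<lambda>n::nat. real (alpha n d) / real n ^ d) \<longlonglongrightarrow> 1)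
       \<and> ((\<lambda>n::nat. real (alpha (n + 1) d) / real (alpha n d)) \<longlonglongrightarrow> 1)"
  using alpha_asymptotic[OF assms] alpha_density[OF assms] alpha_ratio[OF assms] by blast

end
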